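(* Let $\phi$ be an analytic self-map of the upper half-plane $\mathbb{H}$ of parabolic type, i.e. such that $\phi(z)\to\infty$ and $\phi(z)/z\to1$ as $z\to\infty$ non-tangentially. Let $\{w_n=x_n+iy_n\}_{n=0}^{\infty}\subset\mathbb{H}$ be a backward-iteration sequence for $\phi$, i.e. $\phi(w_{n+1})=w_n$ for $n=0,1,2,\dots$, with bounded pseudo-hyperbolic steps $d_n=d(w_n,w_{n+1})\uparrow a<1$, which tends to infinity, and which is furthermore of non-zero-height, i.e. such that $y_n\downarrow\ell_\infty>0$. Assume also that $x_n$ tends to $+\infty$ and let $$b_0=\frac{2a}{\sqrt{1-a^2}}=\lim_{n\to\infty}\frac{x_{n+1}-x_n}{y_n}.$$ Then $$\operatorname{lat.-lim}_{z\to+\infty}\,\bigl(z-\phi(z)\bigr)=b_0\ell_\infty .$$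
   Context: $\mathbb{H}=\{z\in\mathbb{C}:\operatorname{Im} z>0\}$, and $d(z,w)=\left|\frac{w-z}{w-\overline{z}}\right|$ is the pseudo-hyperbolic distance on $\mathbb{H}$. "$z\to\infty$ non-tangentially" means that $z\to\infty$ within a sector $\{|\operatorname{Arg} z-\pi/2|<\theta_0\}$, for each $\theta_0\in(0,\pi/2)$. $\uparrow$ and $\downarrow$ denote monotone (non-decreasing, resp. non-increasing) convergence. That the two expressions for $b_0$ coincide under these hypotheses is another theorem of the paper. Lateral limit: for $R>0$ and $0<\epsilon<1$ let $\mathbb{S}(R,\epsilon)=\{x+iy:\ x\ge R,\ \epsilon\le y\le 1/\epsilon\}$. A complex-valued function $f$ on $\mathbb{H}$ has lateral limit $c\in\mathbb{C}$ at $+\infty$, written $\operatorname{lat.-lim}_{z\to+\infty}f(z)=c$, if $\lim_{\mathbb{S}(R,\epsilon)\ni z\to\infty}f(z)=c$ for every $R>0$ and every $0<\epsilon<1$. *)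

theory Defs
  imports "HOL-Analysis.Analysis"
begin

definition upper_half_plane :: "complex set" where
  "upper_half_plane = {z. Im z > 0}"

definition ph_dist :: "complex \<Rightarrow> complex \<Rightarrow> real" where
  "ph_dist z w = cmod ((w - z) / (w - cnj z))"

definition nt_sector :: "real \<Rightarrow> complex set" where
  "nt_sector \<theta> = {z \<in> upper_half_plane. \<bar>Arg z - pi / 2\<bar> < \<theta>}"

definition nt_tends :: "(complex \<Rightarrow> complex) \<Rightarrow> complex filter \<Rightarrow> bool" where
  "nt_tends f F \<longleftrightarrow>
    (\<forall>\<theta>. 0 < \<theta> \<and> \<theta> < pi / 2 \<longrightarrow>
      filterlim f F (inf at_infinity (principal (nt_sector \<theta>))))"

definition analytic_self_map :: "(complex \<Rightarrow> complex) \<Rightarrow> bool" where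
  "analytic_self_map \<phi> \<longleftrightarrow>
    \<phi> holomorphic_on upper_half_plane \<and> \<phi> ` upper_half_plane \<subseteq> upper_half_plane"

(* Parabolic type, normalised so that the Denjoy--Wolff point is infinity. *)
definition parabolic_type :: "(complex \<Rightarrow> complex) \<Rightarrow> bool" where
  "parabolic_type \<phi> \<longleftrightarrow>
    nt_tends \<phi> at_infinity \<and> nt_tends (\<lambda>z. \<phi> z / z) (nhds 1)"

definition backward_iteration :: "(complex \<Rightarrow> complex) \<Rightarrow> (nat \<Rightarrow> complex) \<Rightarrow> bool" where
  "backward_iteration \<phi> w \<longleftrightarrow>
    (\<forall>n. w n \<in> upper_half_plane) \<and> (\<forall>n. \<phi> (w (Suc n)) = w n)"

definition lat_strip :: "real \<Rightarrow> real \<Rightarrow> complex set" where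
  "lat_strip R \<epsilon> = {z. R \<le> Re z \<and> \<epsilon> \<le> Im z \<and> Im z \<le> 1 / \<epsilon>}"

definition has_lat_lim :: "(complex \<Rightarrow> complex) \<Rightarrow> complex \<Rightarrow> bool" where
  "has_lat_lim f c \<longleftrightarrow>
    (\<forall>R \<epsilon>. 0 < R \<and> 0 < \<epsilon> \<and> \<epsilon> < 1 \<longrightarrow>
      (f \<longlongrightarrow> c) (inf at_infinity (principal (lat_strip R \<epsilon>))))"

end

theory Submission
  imports Defs "HOL-Complex_Analysis.Conformal_Mappings"
begin

text \<open>
  By Julia's lemma \<open>p z = \<phi> z - z\<close> maps the half-plane into its closure, so the
  Schwarz--Pick inequality applies to \<open>p\<close>: on a set of bounded hyperbolic diameter around
  \<open>w\<close> the oscillation of \<open>p\<close> is \<open>O(Im (p w))\<close>.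
  Now \<open>p (w (n+1)) = w n - w (n+1)\<close> has imaginary part tending to 0, and the steps determine the
  limit of its real part up to sign; the oscillation bound excludes sign changes, so
  \<open>p (w n) \<longlonglongrightarrow> - b0 l\<close>. Every point far out in a lateral strip is within bounded
  hyperbolic distance of some \<open>w n\<close>, which transfers the limit to the strip.
\<close>

section \<open>Schwarz-Pick inequalities and Julia's lemma in the upper half-plane\<close>

lemma cmod_diff_cnj_square:
  "(cmod (z - cnj w))\<^sup>2 = (cmod (z - w))\<^sup>2 + 4 * Im z * Im w"
  unfolding cmod_power2 by (simp add: power2_eq_square algebra_simps)

lemma diff_cnj_nonzero:
  assumes "Im z > 0" "Im w > 0"
  shows "z - cnj w \<noteq> 0"
  using assms by (auto simp: complex_eq_iff)

lemma ph_dist_less_1: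
  assumes "Im z > 0" "Im w > 0"
  shows "ph_dist z w < 1"
proof -
  have "(cmod (w - z))\<^sup>2 < (cmod (w - cnj z))\<^sup>2"
    using assms by (simp add: cmod_diff_cnj_square)
  then have "cmod (w - z) < cmod (w - cnj z)"
    by (rule power2_less_imp_less) simp
  moreover have "cmod (w - cnj z) > 0"
    using diff_cnj_nonzero[OF assms(2,1)] by simp
  ultimately show ?thesis by (simp add: ph_dist_def norm_divide)
qed

text \<open>Clears the denominator of \<open>ph_dist\<close>. Once the distance is known to be below
  1, this can be solved for the Euclidean step in terms of the distance and the two heights.\<close>

lemma ph_dist_square:
  assumes "Im z > 0" "Im w > 0"
  shows "(cmod (w - z))\<^sup>2 * (1 - (ph_dist z w)\<^sup>2) = (ph_dist z w)\<^sup>2 * (4 * Im z * Im w)"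
proof -
  have "(ph_dist z w)\<^sup>2 * (cmod (w - cnj z))\<^sup>2 = (cmod (w - z))\<^sup>2"
    using diff_cnj_nonzero[OF assms(2,1)] by (simp add: ph_dist_def norm_divide power_divide)
  then show ?thesis unfolding cmod_diff_cnj_square by (simp add: algebra_simps)
qed

text \<open>Conjugation to the disc: \<open>\<kappa>\<close> inverts the Cayley map u |-> (u - w)/(u
  - cnj w), sending 0 to \<open>w\<close>. Following \<open>f \<circ> \<kappa>\<close> by the Cayley
  map based at \<open>f w\<close> gives \<open>g\<close>, which fixes 0, so the Schwarz lemma
  applies.\<close>

theorem Schwarz_Pick_upper_half_plane:
  assumes hol: "f holomorphic_on upper_half_plane"
    and self: "f ` upper_half_plane \<subseteq> upper_half_plane"
    and z: "Im z > 0" and w: "Im w > 0"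
  shows "ph_dist (f w) (f z) \<le> ph_dist w z"
proof -
  define \<kappa> where "\<kappa> \<zeta> = (w - cnj w * \<zeta>) / (1 - \<zeta>)" for \<zeta>
  define g where "g \<zeta> = (f (\<kappa> \<zeta>) - f w) / (f (\<kappa> \<zeta>) - cnj (f w))" for \<zeta>
  have fpos: "Im (f u) > 0" if "Im u > 0" for u
    using self that by (auto simp: upper_half_plane_def)
  have ne: "1 - \<zeta> \<noteq> 0" if "cmod \<zeta> < 1" for \<zeta> using that by auto
  have \<kappa>_Im: "Im (\<kappa> \<zeta>) > 0" if "cmod \<zeta> < 1" for \<zeta>
  proof -
    have "Im ((w - cnj w * \<zeta>) * cnj (1 - \<zeta>)) = Im w * (1 - (cmod \<zeta>)\<^sup>2)"
      unfolding cmod_power2 by (simp add: power2_eq_square algebra_simps)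
    moreover have "(cmod \<zeta>)\<^sup>2 < 1" using that by (simp add: abs_square_less_1)
    ultimately have "Im ((w - cnj w * \<zeta>) * cnj (1 - \<zeta>)) > 0" using w by simp
    moreover have "Im (\<kappa> \<zeta>) = Im ((w - cnj w * \<zeta>) * cnj (1 - \<zeta>)) / (cmod (1 - \<zeta>))\<^sup>2"
      unfolding \<kappa>_def complex_div_cnj[of _ "1 - \<zeta>"] by (rule Im_divide_of_real)
    ultimately show ?thesis using ne[OF that] by (metis divide_pos_pos norm_eq_zero zero_less_power2)
  qed
  have "\<kappa> holomorphic_on ball 0 1"
    unfolding \<kappa>_def by (intro holomorphic_intros) auto
  then have "(f \<circ> \<kappa>) holomorphic_on ball 0 1"
    by (rule holomorphic_on_compose_gen[OF _ hol]) (auto simp: upper_half_plane_def \<kappa>_Im)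
  moreover have "f (\<kappa> \<zeta>) - cnj (f w) \<noteq> 0" if "\<zeta> \<in> ball 0 1" for \<zeta>
    using that by (intro diff_cnj_nonzero fpos \<kappa>_Im w) simp
  ultimately have ghol: "g holomorphic_on ball 0 1"
    unfolding g_def o_def by (intro holomorphic_on_divide holomorphic_on_diff holomorphic_on_const)
  have g0: "g 0 = 0" by (simp add: g_def \<kappa>_def)
  have glt: "cmod (g \<zeta>) < 1" if "cmod \<zeta> < 1" for \<zeta>
    using ph_dist_less_1[OF fpos[OF w] fpos[OF \<kappa>_Im[OF that]]] by (simp add: g_def ph_dist_def)
  \<comment> \<open>The Cayley image of \<open>z\<close>: its modulus is \<open>ph_dist w z\<close>,
    and that of \<open>g \<zeta>\<close> will be \<open>ph_dist (f w) (f z)\<close>.\<close>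
  define \<zeta> where "\<zeta> = (z - w) / (z - cnj w)"
  have \<zeta>: "cmod \<zeta> < 1" using ph_dist_less_1[OF w z] by (simp add: \<zeta>_def ph_dist_def)
  have "\<kappa> \<zeta> = z"
    using diff_cnj_nonzero[OF z w] diff_cnj_nonzero[OF w w] ne[OF \<zeta>]
    by (simp add: \<kappa>_def \<zeta>_def divide_simps) (simp add: algebra_simps)
  then show ?thesis
    using Schwarz_Lemma(1)[OF ghol g0 glt \<zeta>] by (simp add: g_def \<zeta>_def ph_dist_def)
qed

text \<open>The denominator-free form survives limits, so the image may touch the real axis. This
  matters for \<phi>(z) - z, which Julia's lemma only places in the closed half-plane.\<close>

lemma Schwarz_Pick_quadratic:
  assumes hol: "f holomorphic_on upper_half_plane"
    and nonneg: "\<And>u. Im u > 0 \<Longrightarrow> Im (f u) \<ge> 0"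
    and z: "Im z > 0" and w: "Im w > 0"
  shows "(cmod (f z - f w))\<^sup>2 * (Im z * Im w) \<le> (cmod (z - w))\<^sup>2 * (Im (f z) * Im (f w))"
proof -
  have "(cmod (f z - f w))\<^sup>2 * (Im z * Im w)
      \<le> (cmod (z - w))\<^sup>2 * ((Im (f z) + \<delta>) * (Im (f w) + \<delta>))" if \<delta>: "\<delta> > 0" for \<delta>
  proof -
    \<comment> \<open>The shift by i \<delta> restores a strictly positive imaginary part and leaves
      differences unchanged; \<delta> tends to 0 at the end.\<close>
    let ?g = "\<lambda>u. f u + \<i> * of_real \<delta>"
    have "?g holomorphic_on upper_half_plane" by (intro holomorphic_intros hol)
    moreover have pos: "Im (?g u) > 0" if "Im u > 0" for u
      using nonneg[OF that] \<delta> by simp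
    ultimately have "ph_dist (?g w) (?g z) \<le> ph_dist w z"
      by (intro Schwarz_Pick_upper_half_plane z w) (auto simp: upper_half_plane_def)
    then have "(ph_dist (?g w) (?g z))\<^sup>2 \<le> (ph_dist w z)\<^sup>2"
      by (rule power_mono) (simp add: ph_dist_def)
    moreover have "(cmod (z - cnj w))\<^sup>2 > 0" "(cmod (?g z - cnj (?g w)))\<^sup>2 > 0"
      using diff_cnj_nonzero[OF z w] diff_cnj_nonzero[OF pos[OF z] pos[OF w]] by simp_all
    ultimately have "(cmod (?g z - ?g w))\<^sup>2 * (cmod (z - cnj w))\<^sup>2
        \<le> (cmod (z - w))\<^sup>2 * (cmod (?g z - cnj (?g w)))\<^sup>2"
      by (simp only: ph_dist_def norm_divide power_divide) (simp add: divide_simps)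
    \<comment> \<open>After expansion the product of the two squared differences occurs on both
      sides and cancels, leaving a common factor 4.\<close>
    then show ?thesis
      unfolding cmod_diff_cnj_square by (simp add: algebra_simps)
  qed
  then have "\<forall>\<^sub>F \<delta> in at_right 0. (cmod (f z - f w))\<^sup>2 * (Im z * Im w)
      \<le> (cmod (z - w))\<^sup>2 * ((Im (f z) + \<delta>) * (Im (f w) + \<delta>))"
    by (auto simp: eventually_at_right_field intro: exI[of _ 1])
  moreover have "((\<lambda>\<delta>. (cmod (z - w))\<^sup>2 * ((Im (f z) + \<delta>) * (Im (f w) + \<delta>)))
      \<longlongrightarrow> (cmod (z - w))\<^sup>2 * ((Im (f z) + 0) * (Im (f w) + 0))) (at_right 0)"
    by (intro tendsto_intros)
  ultimately show ?thesis
    by (auto dest: tendsto_lowerbound)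
qed

text \<open>With D = |f z - f w| and t = Im (f w), one has Im (f z) \<le> t + D, so the quadratic
  inequality gives D^2 \<le> K t (t + D). If D > (K + 1) t, then K t \<le> D and D^2 > K t D + t D
  \<ge> K t D + K t^2, a contradiction.\<close>

lemma Schwarz_Pick_oscillation:
  assumes hol: "f holomorphic_on upper_half_plane"
    and nonneg: "\<And>u. Im u > 0 \<Longrightarrow> Im (f u) \<ge> 0"
    and z: "Im z > 0" and w: "Im w > 0"
    and K: "(cmod (z - w))\<^sup>2 \<le> K * (Im z * Im w)"
  shows "cmod (f z - f w) \<le> (K + 1) * Im (f w)"
proof (rule ccontr)
  assume neg: "\<not> ?thesis"
  define D where "D = cmod (f z - f w)"
  define t where "t = Im (f w)"
  have D: "(K + 1) * t < D" using neg by (simp add: D_def t_def)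
  have t: "t \<ge> 0" using nonneg[OF w] by (simp add: t_def)
  have yy: "Im z * Im w > 0" using z w by simp
  have "0 \<le> K * (Im z * Im w)" using K by (rule order_trans[rotated]) simp
  then have "K \<ge> 0" using yy by (simp add: zero_le_mult_iff)
  have "Im (f z) * t \<le> (t + D) * t"
    using abs_Im_le_cmod[of "f z - f w"] t by (intro mult_right_mono) (auto simp: D_def t_def)
  have "D\<^sup>2 * (Im z * Im w) \<le> (cmod (z - w))\<^sup>2 * (Im (f z) * t)"
    unfolding D_def t_def by (rule Schwarz_Pick_quadratic[OF hol nonneg z w])
  also have "\<dots> \<le> K * (Im z * Im w) * ((t + D) * t)"
    using K \<open>Im (f z) * t \<le> (t + D) * t\<close> nonneg[OF z] t \<open>0 \<le> K * (Im z * Im w)\<close>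
    by (intro mult_mono[of _ "K * (Im z * Im w)"]) auto
  finally have "D\<^sup>2 * (Im z * Im w) \<le> (K * ((t + D) * t)) * (Im z * Im w)"
    by (simp add: mult_ac)
  then have "D\<^sup>2 \<le> K * ((t + D) * t)" using yy by (rule mult_right_le_imp_le)
  moreover have "K * t * t \<le> t * D"
  proof -
    have "K * t \<le> D" using D t by (simp add: algebra_simps)
    then have "K * t * t \<le> D * t" using t by (rule mult_right_mono)
    then show ?thesis by (simp add: mult_ac)
  qed
  moreover have "D > 0"
    using D t \<open>K \<ge> 0\<close> by (smt (verit) mult_nonneg_nonneg)
  then have "(K + 1) * t * D < D * D" using D by (simp only: mult_strict_right_mono)
  ultimately show False by (simp add: power2_eq_square algebra_simps)
qed

text \<open>Julia's lemma at infinity: let \<open>w = \<i> y\<close> with \<open>y \<rightarrow> \<infinity>\<close> in the Schwarz--Pick inequality.\<close>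
lemma parabolic_type_Im_ge:
  assumes self: "analytic_self_map \<phi>" and par: "parabolic_type \<phi>" and z: "Im z > 0"
  shows "Im z \<le> Im (\<phi> z)"
proof -
  have hol: "\<phi> holomorphic_on upper_half_plane" and pos: "\<And>u. Im u > 0 \<Longrightarrow> Im (\<phi> u) > 0"
    using self by (auto simp: analytic_self_map_def upper_half_plane_def)
  \<comment> \<open>\<open>Suc n\<close> keeps \<open>v 0\<close> away from 0; points on the
    imaginary axis lie in every sector \<open>nt_sector \<theta>\<close> with \<theta> > 0.\<close>
  define v where "v n = \<i> * of_nat (Suc n)" for n :: nat
  have v_inf: "filterlim v at_infinity sequentially"
    unfolding v_def
    by (intro tendsto_mult_filterlim_at_infinity[of _ \<i>] tendsto_const
          filterlim_compose[OF tendsto_of_nat filterlim_Suc]) auto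
  have v_Arg: "Arg (v n) = pi / 2" for n
    using Arg_times_of_real2[of "real (Suc n)" \<i>] by (simp add: v_def Arg_def del: of_nat_Suc)
  have "Im (v n) > 0" for n by (simp add: v_def)
  then have "v n \<in> nt_sector (pi / 4)" for n
    by (simp add: nt_sector_def upper_half_plane_def v_Arg)
  then have "filterlim v (inf at_infinity (principal (nt_sector (pi / 4)))) sequentially"
    using v_inf by (simp add: filterlim_inf filterlim_principal)
  moreover have "filterlim (\<lambda>z. \<phi> z / z) (nhds 1) (inf at_infinity (principal (nt_sector (pi / 4))))"
    using par by (simp add: parabolic_type_def nt_tends_def)
  ultimately have lim: "(\<lambda>n. \<phi> (v n) / v n) \<longlonglongrightarrow> 1"
    by (rule filterlim_compose[rotated])
  have inv: "(\<lambda>n. c / v n) \<longlonglongrightarrow> 0" for c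
    by (rule tendsto_divide_0[OF tendsto_const v_inf])
  have v0: "v n \<noteq> 0" for n by (simp add: v_def complex_eq_iff)
  have Imv: "Im (\<phi> (v n)) / real (Suc n) = Re (\<phi> (v n) / v n)" for n
    by (simp add: v_def Re_divide power2_eq_square del: of_nat_Suc)
  have Imn: "Im (v n) = real (Suc n)" "cmod (v n) = real (Suc n)" for n
    by (simp_all add: v_def norm_mult del: of_nat_Suc)
  have "(cmod (\<phi> z / v n - \<phi> (v n) / v n))\<^sup>2 * Im z
      \<le> (cmod (z / v n - 1))\<^sup>2 * (Im (\<phi> z) * Re (\<phi> (v n) / v n))" for n
  proof -
    have "(cmod (\<phi> z - \<phi> (v n)))\<^sup>2 * (Im z * real (Suc n))
      \<le> (cmod (z - v n))\<^sup>2 * (Im (\<phi> z) * Im (\<phi> (v n)))"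
      using Schwarz_Pick_quadratic[OF hol less_imp_le[OF pos] z, of "v n"] by (simp add: Imn)
    \<comment> \<open>Of the three factors \<open>Suc n\<close>, two normalise the squared modulus.
      The third cancels Im (v n) on the left and turns Im (\<phi> (v n)) into the real part of the
      quotient on the right.\<close>
    then have "(cmod (\<phi> z - \<phi> (v n)))\<^sup>2 * (Im z * real (Suc n)) / real (Suc n) ^ 3
      \<le> (cmod (z - v n))\<^sup>2 * (Im (\<phi> z) * Im (\<phi> (v n))) / real (Suc n) ^ 3"
      by (rule divide_right_mono) simp
    moreover have "\<phi> z / v n - \<phi> (v n) / v n = (\<phi> z - \<phi> (v n)) / v n"
      "z / v n - 1 = (z - v n) / v n" using v0 by (simp_all add: diff_divide_distrib)
    ultimately show ?thesis
      unfolding Imv[symmetric]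
      by (simp add: norm_divide Imn power_divide power2_eq_square power3_eq_cube del: of_nat_Suc)
  qed
  moreover have "(\<lambda>n. (cmod (\<phi> z / v n - \<phi> (v n) / v n))\<^sup>2 * Im z)
      \<longlonglongrightarrow> (cmod (0 - 1))\<^sup>2 * Im z"
    by (intro tendsto_intros inv lim)
  moreover have "(\<lambda>n. (cmod (z / v n - 1))\<^sup>2 * (Im (\<phi> z) * Re (\<phi> (v n) / v n)))
      \<longlonglongrightarrow> (cmod (0 - 1))\<^sup>2 * (Im (\<phi> z) * Re 1)"
    by (intro tendsto_intros inv lim)
  ultimately have "(cmod (0 - 1))\<^sup>2 * Im z \<le> (cmod (0 - 1))\<^sup>2 * (Im (\<phi> z) * Re 1)"
    by (intro LIMSEQ_le) auto
  then show ?thesis by simp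
qed

section \<open>Increments and crossings of real sequences tending to infinity\<close>

text \<open>For c > 0 the increments eventually exceed c/2 in size while consecutive ones differ by
  less than c/2, so their sign freezes. A negative sign would bound \<open>x\<close> above.\<close>

lemma increments_tendsto:
  fixes x :: "nat \<Rightarrow> real"
  assumes abs: "(\<lambda>n. \<bar>x (Suc n) - x n\<bar>) \<longlonglongrightarrow> c"
    and slow: "(\<lambda>n. (x (Suc (Suc n)) - x (Suc n)) - (x (Suc n) - x n)) \<longlonglongrightarrow> 0"
    and top: "filterlim x at_top sequentially"
  shows "(\<lambda>n. x (Suc n) - x n) \<longlonglongrightarrow> c"
proof (cases "c = 0")
  case True
  then show ?thesis using abs by (simp add: tendsto_rabs_zero_iff)
next
  case False
  have "c \<ge> 0" by (rule LIMSEQ_le_const[OF abs]) simp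
  then have c: "c > 0" using False by simp
  define u where "u n = x (Suc n) - x n" for n
  have large: "\<forall>\<^sub>F n in sequentially. \<bar>u n\<bar> > c / 2"
    using order_tendstoD(1)[OF abs, of "c / 2"] c by (simp add: u_def)
  have small: "\<forall>\<^sub>F n in sequentially. \<bar>u (Suc n) - u n\<bar> < c / 2"
    using tendstoD[OF slow, of "c / 2"] c by (simp add: u_def dist_real_def)
  obtain N where N: "\<And>n. n \<ge> N \<Longrightarrow> \<bar>u n\<bar> > c / 2 \<and> \<bar>u (Suc n) - u n\<bar> < c / 2"
    using eventually_conj[OF large small] unfolding eventually_sequentially by blast
  have pos_step: "u (Suc n) > 0 \<longleftrightarrow> u n > 0" if "n \<ge> N" for n
    using N[OF that] c by linarith
  have sgn: "u n > 0 \<longleftrightarrow> u N > 0" if "n \<ge> N" for n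
    using that by (induction n rule: dec_induct) (simp_all only: pos_step)
  have "u N > 0"
  proof (rule ccontr)
    assume "\<not> u N > 0"
    then have dec: "x (Suc n) \<le> x n" if "n \<ge> N" for n
      using sgn[OF that] by (simp add: u_def)
    have "x n \<le> x N" if "n \<ge> N" for n
      using that by (induction n rule: dec_induct) (auto intro: order_trans[OF dec])
    moreover have "\<forall>\<^sub>F n in sequentially. x n > x N \<and> n \<ge> N"
      using top by (intro eventually_conj eventually_ge_at_top) (simp add: filterlim_at_top_dense)
    then obtain n where "x n > x N" "n \<ge> N"
      by (auto dest: eventually_happens)
    ultimately show False by (simp add: leD)
  qed
  then have "\<bar>u n\<bar> = u n" if "n \<ge> N" for n
    using sgn[OF that] by simp
  then have "\<forall>\<^sub>F n in sequentially. \<bar>u n\<bar> = u n"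
    unfolding eventually_sequentially by blast
  then show ?thesis
    using abs unfolding u_def by (rule Lim_transform_eventually[rotated])
qed

text \<open>\<open>x\<close> need not be monotone: the predecessor of the first index from
  \<open>N\<close> on with value above \<open>X\<close> works.\<close>

lemma bracketing_index:
  fixes x :: "nat \<Rightarrow> real"
  assumes "filterlim x at_top sequentially" "x N \<le> X"
  obtains n where "n \<ge> N" "x n \<le> X" "X < x (Suc n)"
proof -
  have "\<forall>\<^sub>F n in sequentially. N \<le> n \<and> X < x n"
    using assms(1) by (intro eventually_conj eventually_ge_at_top) (simp add: filterlim_at_top_dense)
  then have "\<exists>n. N \<le> n \<and> X < x n"
    by (auto dest: eventually_happens)
  then obtain m where m: "N \<le> m" "X < x m" and least: "\<And>k. k < m \<Longrightarrow> \<not> (N \<le> k \<and> X < x k)"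
    using exists_least_iff[of "\<lambda>n. N \<le> n \<and> X < x n"] by blast
  have "m \<noteq> N" using m assms(2) by auto
  then obtain n where n: "m = Suc n" "N \<le> n" using m(1) by (cases m) auto
  then have "x n \<le> X" using least[of n] by simp
  then show thesis using that n m by simp
qed

section \<open>The lateral limit\<close>

theorem proposition1p19:
  fixes \<phi> :: "complex \<Rightarrow> complex" and w :: "nat \<Rightarrow> complex" and a l b0 :: real
  assumes "analytic_self_map \<phi>"
    and "parabolic_type \<phi>"
    and "backward_iteration \<phi> w"
    and "incseq (\<lambda>n. ph_dist (w n) (w (Suc n)))"
    and "(\<lambda>n. ph_dist (w n) (w (Suc n))) \<longlonglongrightarrow> a"
    and "a < 1"
    and "filterlim w at_infinity sequentially"
    and "decseq (\<lambda>n. Im (w n))"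
    and "(\<lambda>n. Im (w n)) \<longlonglongrightarrow> l"
    and "l > 0"
    and "filterlim (\<lambda>n. Re (w n)) at_top sequentially"
    and "b0 = 2 * a / sqrt (1 - a\<^sup>2)"
  shows "has_lat_lim (\<lambda>z. z - \<phi> z) (complex_of_real (b0 * l))"
proof -
  define p where "p z = \<phi> z - z" for z
  define d where "d n = ph_dist (w n) (w (Suc n))" for n
  define u where "u n = Re (w (Suc n)) - Re (w n)" for n
  have hol: "p holomorphic_on upper_half_plane"
    using assms(1) unfolding p_def analytic_self_map_def by (intro holomorphic_intros) auto
  have nonneg: "Im (p z) \<ge> 0" if "Im z > 0" for z
    using parabolic_type_Im_ge[OF assms(1,2) that] by (simp add: p_def)
  have wpos: "Im (w n) > 0" for n
    using assms(3) by (auto simp: backward_iteration_def upper_half_plane_def)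
  have pw: "p (w (Suc n)) = w n - w (Suc n)" for n
    using assms(3) by (simp add: backward_iteration_def p_def)
  have a0: "0 \<le> a"
    by (rule LIMSEQ_le_const[OF assms(5)]) (simp add: ph_dist_def)
  then have a1: "1 - a\<^sup>2 > 0" using assms(6) by (simp add: abs_square_less_1)
  have d_lim: "d \<longlonglongrightarrow> a" using assms(5) by (simp add: d_def[abs_def])
  have b0l: "b0 * l \<ge> 0" using assms(10,12) a0 a1 by simp
  have l_le: "l \<le> Im (w n)" for n
    using decseq_ge[OF assms(8,9)] .
  have le_y0: "Im (w n) \<le> Im (w 0)" for n
    using decseqD[OF assms(8), of 0 n] by simp
  have Suc_y: "(\<lambda>n. Im (w (Suc n))) \<longlonglongrightarrow> l"
    using assms(9) by (rule LIMSEQ_Suc)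

  have step: "(cmod (w (Suc n) - w n))\<^sup>2 = (d n)\<^sup>2 * (4 * Im (w n) * Im (w (Suc n))) / (1 - (d n)\<^sup>2)" for n
  proof -
    have "d n < 1" "d n \<ge> 0" unfolding d_def
      by (simp_all add: ph_dist_less_1 wpos) (simp add: ph_dist_def)
    then have "1 - (d n)\<^sup>2 > 0" by (simp add: abs_square_less_1)
    then show ?thesis
      using ph_dist_square[OF wpos[of n] wpos[of "Suc n"]] by (simp add: d_def nonzero_eq_divide_eq)
  qed
  have "(\<lambda>n. (cmod (w (Suc n) - w n))\<^sup>2) \<longlonglongrightarrow> a\<^sup>2 * (4 * l * l) / (1 - a\<^sup>2)"
    unfolding step using a1 by (intro tendsto_intros d_lim assms(9) Suc_y) auto
  moreover have "a\<^sup>2 * (4 * l * l) / (1 - a\<^sup>2) = (b0 * l)\<^sup>2"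
    using a1 by (simp add: assms(12) power_mult_distrib power_divide) (simp add: power2_eq_square)
  ultimately have sq_lim: "(\<lambda>n. (cmod (w (Suc n) - w n))\<^sup>2) \<longlonglongrightarrow> (b0 * l)\<^sup>2"
    by simp
  have Im_lim: "(\<lambda>n. Im (w n) - Im (w (Suc n))) \<longlonglongrightarrow> 0"
    using tendsto_diff[OF assms(9) Suc_y] by simp
  \<comment> \<open>Removing the vanishing vertical part of the step leaves the horizontal
    increment, so far only in absolute value.\<close>
  have "(\<lambda>n. sqrt ((cmod (w (Suc n) - w n))\<^sup>2 - (Im (w n) - Im (w (Suc n)))\<^sup>2))
      \<longlonglongrightarrow> sqrt ((b0 * l)\<^sup>2 - 0\<^sup>2)"
    by (intro tendsto_intros sq_lim Im_lim)
  moreover have "(cmod (w (Suc n) - w n))\<^sup>2 - (Im (w n) - Im (w (Suc n)))\<^sup>2 = (u n)\<^sup>2" for n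
    by (simp add: cmod_power2 u_def power2_commute)
  ultimately have abs_u: "(\<lambda>n. \<bar>u n\<bar>) \<longlonglongrightarrow> b0 * l"
    using b0l by simp

  have "Bseq (\<lambda>n. (cmod (w (Suc n) - w n))\<^sup>2)"
    using sq_lim by (intro convergent_imp_Bseq convergentI)
  then obtain M where M: "M > 0" "\<And>n. (cmod (w (Suc n) - w n))\<^sup>2 \<le> M"
    by (auto simp: Bseq_def)
  \<comment> \<open>The indices start at \<open>Suc n\<close> because \<open>pw\<close> identifies
    \<open>p\<close> only there. All heights are at least \<open>l\<close> and squared steps at most
    \<open>M\<close>, hence K = M/l^2.\<close>
  have osc: "cmod (p (w (Suc (Suc n))) - p (w (Suc n))) \<le> (M / (l * l) + 1) * Im (p (w (Suc n)))" for n
  proof (rule Schwarz_Pick_oscillation[OF hol nonneg wpos wpos])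
    have "l * l \<le> Im (w (Suc (Suc n))) * Im (w (Suc n))"
      using l_le assms(10) wpos by (intro mult_mono) (auto intro: less_imp_le)
    then have "M / (l * l) * (l * l) \<le> M / (l * l) * (Im (w (Suc (Suc n))) * Im (w (Suc n)))"
      using M(1) by (intro mult_left_mono) auto
    then show "(cmod (w (Suc (Suc n)) - w (Suc n)))\<^sup>2
        \<le> M / (l * l) * (Im (w (Suc (Suc n))) * Im (w (Suc n)))"
      using M(2)[of "Suc n"] assms(10) by simp
  qed
  have Imp: "(\<lambda>n. Im (p (w (Suc n)))) \<longlonglongrightarrow> 0"
    using Im_lim by (simp add: pw)
  have "(\<lambda>n. u (Suc n) - u n) \<longlonglongrightarrow> 0"
  proof (rule Lim_null_comparison)
    have "(\<lambda>n. (M / (l * l) + 1) * Im (p (w (Suc n)))) \<longlonglongrightarrow> (M / (l * l) + 1) * 0"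
      by (intro tendsto_intros Imp)
    then show "(\<lambda>n. (M / (l * l) + 1) * Im (p (w (Suc n)))) \<longlonglongrightarrow> 0" by simp
    \<comment> \<open>Re (p (w (Suc n))) = - u n, so the second differences of Re (w n) are
      controlled by the oscillation of \<open>p\<close>.\<close>
    have "\<bar>u (Suc n) - u n\<bar> \<le> cmod (p (w (Suc (Suc n))) - p (w (Suc n)))" for n
      using abs_Re_le_cmod[of "p (w (Suc (Suc n))) - p (w (Suc n))"] by (simp add: pw u_def)
    then show "\<forall>\<^sub>F n in sequentially. norm (u (Suc n) - u n) \<le> (M / (l * l) + 1) * Im (p (w (Suc n)))"
      using osc by (auto intro: always_eventually order_trans)
  qed
  then have u_lim: "u \<longlonglongrightarrow> b0 * l"
    using increments_tendsto[of "\<lambda>n. Re (w n)" "b0 * l"] abs_u assms(11)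
    by (simp add: u_def[abs_def])
  have "(\<lambda>n. Complex (- u n) (Im (w n) - Im (w (Suc n)))) \<longlonglongrightarrow> Complex (- (b0 * l)) 0"
    by (intro tendsto_Complex tendsto_intros u_lim Im_lim)
  moreover have "p (w (Suc n)) = Complex (- u n) (Im (w n) - Im (w (Suc n)))" for n
    by (simp add: pw u_def complex_eq_iff)
  ultimately have "(\<lambda>n. p (w (Suc n))) \<longlonglongrightarrow> - complex_of_real (b0 * l)"
    by (simp add: Complex_eq)
  then have p_lim: "(\<lambda>n. p (w n)) \<longlonglongrightarrow> - complex_of_real (b0 * l)"
    by (rule LIMSEQ_imp_Suc)
  have Imp': "(\<lambda>n. Im (p (w n))) \<longlonglongrightarrow> 0"
    using Imp by (rule LIMSEQ_imp_Suc)

  have "((\<lambda>z. z - \<phi> z) \<longlongrightarrow> complex_of_real (b0 * l)) (inf at_infinity (principal (lat_strip R \<epsilon>)))"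
    if R: "R > 0" and \<epsilon>: "\<epsilon> > 0" for R \<epsilon>
  proof (rule tendstoI)
    fix e :: real assume e: "e > 0"
    \<comment> \<open>\<open>L\<close> will bound |z - w n|: \<open>sqrt M\<close> covers the
      horizontal gap once Re z is bracketed by consecutive Re (w n), and the two heights cover the
      vertical gap. In \<open>K\<close>, the product \<epsilon> l is a lower bound for Im z * Im (w
      n).\<close>
    define L where "L = sqrt M + 1 / \<epsilon> + Im (w 0)"
    define K where "K = L\<^sup>2 / (\<epsilon> * l)"
    have "(\<lambda>n. (K + 1) * Im (p (w n)) + dist (p (w n)) (- complex_of_real (b0 * l)))
        \<longlonglongrightarrow> (K + 1) * 0 + dist (- complex_of_real (b0 * l)) (- complex_of_real (b0 * l))"
      by (intro tendsto_intros Imp' p_lim)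
    then have "\<forall>\<^sub>F n in sequentially.
        (K + 1) * Im (p (w n)) + dist (p (w n)) (- complex_of_real (b0 * l)) < e"
      using e by (intro order_tendstoD(2)) auto
    then obtain N where N: "\<And>n. n \<ge> N \<Longrightarrow>
        (K + 1) * Im (p (w n)) + dist (p (w n)) (- complex_of_real (b0 * l)) < e"
      by (auto simp: eventually_sequentially)
    have "dist (z - \<phi> z) (complex_of_real (b0 * l)) < e"
      if zS: "z \<in> lat_strip R \<epsilon>" and zn: "cmod z \<ge> \<bar>Re (w N)\<bar> + 1 / \<epsilon>" for z
    proof -
      have z: "\<epsilon> \<le> Im z" "Im z \<le> 1 / \<epsilon>" "Re z \<ge> R" "Im z > 0"
        using zS \<epsilon> by (auto simp: lat_strip_def)
      \<comment> \<open>In the strip |z| \<le> Re z + 1/\<epsilon>, so a large modulus forces a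
        large real part.\<close>
      have "Re (w N) \<le> Re z" using cmod_le[of z] zn z R by linarith
      then obtain n where n: "n \<ge> N" "Re (w n) \<le> Re z" "Re z < Re (w (Suc n))"
        using bracketing_index[OF assms(11)] by metis
      have "Re (w (Suc n)) - Re (w n) \<le> cmod (w (Suc n) - w n)"
        using complex_Re_le_cmod[of "w (Suc n) - w n"] by simp
      also have "\<dots> \<le> sqrt M" using M(2)[of n] by (rule real_le_rsqrt)
      finally have "cmod (z - w n) \<le> L"
        using cmod_le[of "z - w n"] n z wpos[of n] wpos[of 0] le_y0[of n]
        unfolding L_def by simp
      then have "(cmod (z - w n))\<^sup>2 \<le> L\<^sup>2" by (intro power_mono) auto
      also have "\<dots> = K * (\<epsilon> * l)" using \<epsilon> assms(10) by (simp add: K_def)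
      also have "\<dots> \<le> K * (Im z * Im (w n))"
        using \<epsilon> assms(10) z l_le[of n] by (intro mult_left_mono mult_mono) (auto simp: K_def)
      finally have "cmod (p z - p (w n)) \<le> (K + 1) * Im (p (w n))"
        using Schwarz_Pick_oscillation[OF hol _ z(4) wpos] nonneg by blast
      then have "dist (p z) (- complex_of_real (b0 * l)) < e"
        using N[OF n(1)] dist_triangle[of "p z" "- complex_of_real (b0 * l)" "p (w n)"]
        by (simp add: dist_norm)
      moreover have "dist (p z) (- complex_of_real (b0 * l)) = dist (z - \<phi> z) (complex_of_real (b0 * l))"
        unfolding dist_norm p_def
        by (subst norm_minus_cancel[symmetric]) (simp add: algebra_simps)
      ultimately show ?thesis by simp
    qed
    then show "\<forall>\<^sub>F z in inf at_infinity (principal (lat_strip R \<epsilon>)).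
        dist (z - \<phi> z) (complex_of_real (b0 * l)) < e"
      by (auto simp: eventually_inf_principal eventually_at_infinity
            intro!: exI[of _ "\<bar>Re (w N)\<bar> + 1 / \<epsilon>"])
  qed
  then show ?thesis by (simp add: has_lat_lim_def)
qed

end
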